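(* Let $\Psi:\Lambda\to\big(L_+^2[t_0,t_f]\big)^{|\mathcal{P}|}$ be the effective path delay operator, and let $\varepsilon(\cdot)=\big(\varepsilon_{ij}^p(\cdot):p\in\mathcal{P}_{ij},(i,j)\in\mathcal{W}\big):\Lambda\to\mathbb{R}_+^{|\mathcal{P}|}$ be variable tolerances that are uniformly bounded, i.e. $$0<\sup\left\{\varepsilon_{ij}^p(h):\ p\in\mathcal{P}_{ij},\ (i,j)\in\mathcal{W},\ h\in\Lambda\right\}<+\infty .$$ Then the operator $\Phi^{\varepsilon}:h\mapsto(\Phi^{\varepsilon}_p(\cdot,h):p\in\mathcal{P})$ given by $$\Phi_p^{\varepsilon}(t,h)=\max\left\{\Psi_p(t,h),\ v_{ij}(h)+\varepsilon_{ij}^p(h)\right\}-\left(\varepsilon_{ij}^p(h)-\min_{q\in\mathcal{P}_{ij}}\varepsilon_{ij}^q(h)\right),\qquad p\in\mathcal{P}_{ij},\ t\in[t_0,t_f],$$ exists and is a well-defined mapping from $\Lambda$ to $\big(L_+^2[t_0,t_f]\big)^{|\mathcal{P}|}$.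
   Context: $[t_0,t_f]\subset\mathbb{R}$ is a compact time interval; $\mathcal{W}$ is a finite set of origin-destination (O-D) pairs; $\mathcal{P}$ is the finite set of paths, the disjoint union of the nonempty sets $\mathcal{P}_{ij}$ of paths connecting $(i,j)\in\mathcal{W}$. $\mathbb{R}_+$ (resp. $\mathbb{R}_{++}$) denotes the nonnegative (resp. positive) reals; $L^2_+[t_0,t_f]$ is the set of nonnegative functions in $L^2[t_0,t_f]$. For given demands $Q_{ij}\in\mathbb{R}_{++}$, the feasible set is $$\Lambda=\Big\{h=(h_p)_{p\in\mathcal{P}}\in\big(L_+^2[t_0,t_f]\big)^{|\mathcal{P}|}:\ \sum_{p\in\mathcal{P}_{ij}}\int_{t_0}^{t_f}h_p(t)\,dt=Q_{ij}\ \ \forall (i,j)\in\mathcal{W}\Big\}.$$ The path delay operator assigns to each $h$ the vector of path travel times $D(h)=(D_p(\cdot,h))_{p\in\mathcal{P}}\in(L^2_+[t_0,t_f])^{|\mathcal{P}|}$. The effective path delay operator $\Psi$ assigns to $h$ the vector $\Psi(h)=(\Psi_p(\cdot,h))_{p\in\mathcal{P}}\in(L_+^2[t_0,t_f])^{|\mathcal{P}|}$ with $\Psi_p(t,h)=D_p(t,h)+f(t+D_p(t,h)-T_A)$, where $f$ is a nonnegative arrival penalty function and $T_A$ is the desired arrival time (possibly depending on the O-D pair). Standing assumption: each $\Psi_p(\cdot,h)$ is measurable, positive almost everywhere and square integrable, and its essential infimum is positive. Define $$v_p(h)=\operatorname*{ess\,inf}_{t\in[t_0,t_f]}\Psi_p(t,h)>0,\qquad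 v_{ij}(h)=\min_{p\in\mathcal{P}_{ij}}v_p(h).$$ *)

theory Defs
  imports "HOL-Analysis.Analysis" "HOL-Probability.Essential_Supremum"
begin

text \<open>The space \<open>L\<^sup>2\<close> of a measure, as a set of classes of real functions modulo equality almost
  everywhere. For \<open>M = lebesgue_on {t0..tf}\<close> the functions are total on the reals, but their
  values outside the interval do not affect the class.\<close>

definition square_integrable :: "'a measure \<Rightarrow> ('a \<Rightarrow> real) set" where
  "square_integrable M = {f \<in> borel_measurable M. integrable M (\<lambda>x. (f x)\<^sup>2)}"

definition L2_rel :: "'a measure \<Rightarrow> (('a \<Rightarrow> real) \<times> ('a \<Rightarrow> real)) set" where
  "L2_rel M = {(f, g). f \<in> square_integrable M \<and> g \<in> square_integrable M \<and> (AE x in M. f x = g x)}"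

definition L2 :: "'a measure \<Rightarrow> ('a \<Rightarrow> real) set set" where
  "L2 M = square_integrable M // L2_rel M"

definition L2_plus :: "'a measure \<Rightarrow> ('a \<Rightarrow> real) set set" where
  "L2_plus M = {F \<in> L2 M. \<forall>f\<in>F. AE x in M. 0 \<le> f x}"

text \<open>The class of \<open>f\<close>. It is empty, hence not an element of \<open>L2 M\<close>, if \<open>f\<close> is not
  measurable or not square integrable.\<close>

definition L2_class :: "'a measure \<Rightarrow> ('a \<Rightarrow> real) \<Rightarrow> ('a \<Rightarrow> real) set" where
  "L2_class M f = L2_rel M `` {f}"

lemma equiv_L2_rel: "equiv (square_integrable M) (L2_rel M)"
  by (rule equivI) (auto simp: L2_rel_def refl_on_def intro!: symI transI)

text \<open>Integral and essential infimum of a class are those of a representative; the two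
  lemmas \<open>L2_integral_eq\<close> and \<open>L2_essinf_eq\<close> show that any representative gives the same value.\<close>

definition L2_integral :: "'a measure \<Rightarrow> ('a \<Rightarrow> real) set \<Rightarrow> real" where
  "L2_integral M F = (\<integral>x. (SOME f. f \<in> F) x \<partial>M)"

definition essinf :: "'a measure \<Rightarrow> ('a \<Rightarrow> real) \<Rightarrow> ereal" where
  "essinf M f = - esssup M (\<lambda>x. - ereal (f x))"

definition L2_essinf :: "'a measure \<Rightarrow> ('a \<Rightarrow> real) set \<Rightarrow> ereal" where
  "L2_essinf M F = essinf M (SOME f. f \<in> F)"

lemma L2_some_rep:
  assumes "F \<in> L2 M" "f \<in> F"
  shows "(SOME g. g \<in> F) \<in> F" "f \<in> borel_measurable M"
    "(SOME g. g \<in> F) \<in> borel_measurable M" "AE x in M. (SOME g. g \<in> F) x = f x"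
proof -
  show s: "(SOME g. g \<in> F) \<in> F" using assms(2) by (rule someI[where P = "\<lambda>g. g \<in> F"])
  have "((SOME g. g \<in> F), f) \<in> L2_rel M"
    using quotient_eq_iff[OF equiv_L2_rel, of F M F "SOME g. g \<in> F" f] assms s
    by (simp add: L2_def)
  then show "f \<in> borel_measurable M" "(SOME g. g \<in> F) \<in> borel_measurable M"
    "AE x in M. (SOME g. g \<in> F) x = f x"
    by (auto simp: L2_rel_def square_integrable_def)
qed

lemma L2_integral_eq:
  assumes "F \<in> L2 M" "f \<in> F"
  shows "L2_integral M F = (\<integral>x. f x \<partial>M)"
  unfolding L2_integral_def using L2_some_rep[OF assms] by (intro integral_cong_AE) auto

lemma L2_essinf_eq:
  assumes "F \<in> L2 M" "f \<in> F"
  shows "L2_essinf M F = essinf M f"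
  unfolding L2_essinf_def essinf_def using L2_some_rep[OF assms]
  by (intro arg_cong[where f = uminus] esssup_AE_cong) auto

lemma essinf_eq:
  assumes "f \<in> borel_measurable M"
  shows "essinf M f = Sup {c. AE x in M. c \<le> ereal (f x)}"
proof -
  have a: "(\<lambda>x. - ereal (f x)) \<in> borel_measurable M" using assms by measurable
  have b: "AE x in M. essinf M f \<le> ereal (f x)"
    using esssup_AE[of "\<lambda>x. - ereal (f x)" M] by (auto simp: essinf_def ereal_uminus_le_reorder)
  have c: "c \<le> essinf M f" if "AE x in M. c \<le> ereal (f x)" for c
  proof -
    have "esssup M (\<lambda>x. - ereal (f x)) \<le> - c"
      using that by (intro esssup_I[OF a]) (auto simp: ereal_minus_le_minus simp flip: uminus_ereal.simps)
    then show ?thesis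
      unfolding essinf_def by (metis ereal_minus_le_minus ereal_uminus_uminus)
  qed
  show ?thesis using b c by (intro antisym Sup_upper Sup_least) auto
qed

text \<open>In the following, \<open>M\<close> is \<open>lebesgue_on {t0..tf}\<close>, \<open>Pij w\<close> is the set of paths connecting
  the O-D pair \<open>w\<close>, and \<open>Q w\<close> its demand. A vector indexed by a set of paths is a function that
  is \<open>undefined\<close> off that set.\<close>

definition feasible_set ::
  "real measure \<Rightarrow> ('n \<times> 'n) set \<Rightarrow> ('n \<times> 'n \<Rightarrow> 'p set) \<Rightarrow> ('n \<times> 'n \<Rightarrow> real)
    \<Rightarrow> ('p \<Rightarrow> (real \<Rightarrow> real) set) set" where
  "feasible_set M W Pij Q =
    {h \<in> (\<Union>w\<in>W. Pij w) \<rightarrow>\<^sub>E L2_plus M.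
      \<forall>w\<in>W. (\<Sum>p\<in>Pij w. L2_integral M (h p)) = Q w}"

text \<open>\<open>v_p(h)\<close> and \<open>v_ij(h)\<close>. The conversion from \<open>ereal\<close> is harmless when \<open>t0 < tf\<close>, as the
  essential infimum of a nonnegative function is then finite; when \<open>t0 = tf\<close> and the demands
  are positive, there is no feasible \<open>h\<close>.\<close>

definition v_path ::
  "real measure \<Rightarrow> (('p \<Rightarrow> (real \<Rightarrow> real) set) \<Rightarrow> 'p \<Rightarrow> (real \<Rightarrow> real) set)
    \<Rightarrow> ('p \<Rightarrow> (real \<Rightarrow> real) set) \<Rightarrow> 'p \<Rightarrow> real" where
  "v_path M \<Psi> h p = real_of_ereal (L2_essinf M (\<Psi> h p))"

definition v_od ::
  "real measure \<Rightarrow> ('n \<times> 'n \<Rightarrow> 'p set)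
    \<Rightarrow> (('p \<Rightarrow> (real \<Rightarrow> real) set) \<Rightarrow> 'p \<Rightarrow> (real \<Rightarrow> real) set)
    \<Rightarrow> ('p \<Rightarrow> (real \<Rightarrow> real) set) \<Rightarrow> 'n \<times> 'n \<Rightarrow> real" where
  "v_od M Pij \<Psi> h w = (MIN p\<in>Pij w. v_path M \<Psi> h p)"

end

theory Submission
  imports Defs
begin

text \<open>The formula for \<Phi> is pointwise in t, with coefficients that depend on h and p only,
  so three things need checking. Square integrability: \<open>M\<close> is finite, hence constants
  are square integrable, and truncating below by a constant and shifting by another stays in
  \<open>square_integrable M\<close> (\<open>square_integrable_max_diff\<close>). Nonnegativity: the
  maximum is at least v_ij + \<epsilon>_p, and subtracting \<epsilon>_p - min \<epsilon>_q leaves at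
  least v_ij + min \<epsilon>_q, a sum of nonnegative numbers. Independence of choices:
  representatives of one class agree almost everywhere, so their images do too
  (\<open>L2_class_cong\<close>), and disjointness of the path sets attaches a single O-D pair to
  each path. Uniqueness follows because every class has a representative
  (\<open>L2_nonempty\<close>), so the formula prescribes the value at every feasible h and every
  path, while extensionality prescribes it elsewhere.\<close>

lemma L2_class_in_L2_plus:
  assumes "f \<in> square_integrable M" "AE x in M. 0 \<le> f x"
  shows "L2_class M f \<in> L2_plus M"
proof -
  have "L2_class M f \<in> L2 M"
    unfolding L2_def L2_class_def using assms(1) by (rule quotientI)
  moreover have "AE x in M. 0 \<le> g x" if "g \<in> L2_class M f" for g
  proof -
    have "AE x in M. f x = g x" using that by (simp add: L2_class_def L2_rel_def)
    with assms(2) show ?thesis by eventually_elim simp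
  qed
  ultimately show ?thesis by (simp add: L2_plus_def)
qed

lemma L2_class_cong:
  assumes "f \<in> square_integrable M" "g \<in> square_integrable M" "AE x in M. f x = g x"
  shows "L2_class M f = L2_class M g"
  unfolding L2_class_def
  using assms by (intro equiv_class_eq[OF equiv_L2_rel]) (simp add: L2_rel_def)

lemma L2_nonempty: "F \<in> L2 M \<Longrightarrow> F \<noteq> {}"
  unfolding L2_def using in_quotient_imp_non_empty[OF equiv_L2_rel] .

lemma L2_subset: "F \<in> L2 M \<Longrightarrow> F \<subseteq> square_integrable M"
  unfolding L2_def using in_quotient_imp_subset[OF equiv_L2_rel] .

lemma L2_rep_AE_eq:
  assumes "F \<in> L2 M" "f \<in> F" "g \<in> F"
  shows "AE x in M. f x = g x"
  using L2_some_rep(4)[OF assms(1,2)] L2_some_rep(4)[OF assms(1,3)] by eventually_elim simp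

text \<open>The function is dominated by \<bar>f\<bar> + k with k = \<bar>c\<bar> + \<bar>e\<bar>,
  and the square of that by 2 f^2 + 2 k^2; finiteness of the measure makes the constant term
  integrable.\<close>

lemma (in finite_measure) square_integrable_max_diff:
  assumes "f \<in> square_integrable M"
  shows "(\<lambda>x. max (f x) c - e) \<in> square_integrable M"
proof -
  define k where "k = \<bar>c\<bar> + \<bar>e\<bar>"
  have f: "f \<in> borel_measurable M" "integrable M (\<lambda>x. (f x)\<^sup>2)"
    using assms by (auto simp: square_integrable_def)
  have "(max (f x) c - e)\<^sup>2 \<le> 2 * (f x)\<^sup>2 + 2 * k\<^sup>2" for x
  proof -
    have "\<bar>max (f x) c - e\<bar> \<le> \<bar>\<bar>f x\<bar> + k\<bar>" by (auto simp: k_def max_def)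
    then have "(max (f x) c - e)\<^sup>2 \<le> (\<bar>f x\<bar> + k)\<^sup>2" by (simp only: abs_le_square_iff)
    also have "\<dots> \<le> 2 * (f x)\<^sup>2 + 2 * k\<^sup>2"
      \<comment> \<open>The right side exceeds the left by exactly (\<bar>f x\<bar> - k)^2.\<close>
      using zero_le_power2[of "\<bar>f x\<bar> - k"] by (simp add: power2_sum power2_diff)
    finally show ?thesis .
  qed
  moreover have "integrable M (\<lambda>x. 2 * (f x)\<^sup>2 + 2 * k\<^sup>2)"
    using f(2) by simp
  moreover have meas: "(\<lambda>x. max (f x) c - e) \<in> borel_measurable M"
    using f(1) by measurable
  ultimately have "integrable M (\<lambda>x. (max (f x) c - e)\<^sup>2)"
    by - (rule Bochner_Integration.integrable_bound[where f = "\<lambda>x. 2 * (f x)\<^sup>2 + 2 * k\<^sup>2"],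
      simp_all)
  with meas show ?thesis by (simp add: square_integrable_def)
qed

theorem proposition4p1:
  fixes t0 tf :: real
    and W :: "('n \<times> 'n) set"
    and Pij :: "'n \<times> 'n \<Rightarrow> 'p set"
    and P :: "'p set"
    and Q T\<^sub>A :: "'n \<times> 'n \<Rightarrow> real"
    and f :: "real \<Rightarrow> real"
    and M :: "real measure"
    and \<Lambda> :: "('p \<Rightarrow> (real \<Rightarrow> real) set) set"
    and D \<Psi> :: "('p \<Rightarrow> (real \<Rightarrow> real) set) \<Rightarrow> 'p \<Rightarrow> (real \<Rightarrow> real) set"
    and \<epsilon> :: "('p \<Rightarrow> (real \<Rightarrow> real) set) \<Rightarrow> 'p \<Rightarrow> real"
  assumes "t0 \<le> tf"
    and M: "M = lebesgue_on {t0..tf}"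
    and "finite W"
    and P: "P = (\<Union>w\<in>W. Pij w)"
    and "finite P"
    and "\<And>w. w \<in> W \<Longrightarrow> Pij w \<noteq> {}"
    and "disjoint_family_on Pij W"
    and "\<And>w. w \<in> W \<Longrightarrow> 0 < Q w"
    and \<Lambda>: "\<Lambda> = feasible_set M W Pij Q"
    and D: "D \<in> \<Lambda> \<rightarrow> (P \<rightarrow>\<^sub>E L2_plus M)"
    and f: "\<And>x. 0 \<le> f x"
    and \<Psi>: "\<Psi> \<in> \<Lambda> \<rightarrow> (P \<rightarrow>\<^sub>E L2_plus M)"
    and \<Psi>_eq: "\<And>h w p d. h \<in> \<Lambda> \<Longrightarrow> w \<in> W \<Longrightarrow> p \<in> Pij w \<Longrightarrow> d \<in> D h p \<Longrightarrow>
      \<Psi> h p = L2_class M (\<lambda>t. d t + f (t + d t - T\<^sub>A w))"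
    and \<Psi>_pos: "\<And>h p \<psi>. h \<in> \<Lambda> \<Longrightarrow> p \<in> P \<Longrightarrow> \<psi> \<in> \<Psi> h p \<Longrightarrow> AE t in M. 0 < \<psi> t"
    and \<Psi>_essinf: "\<And>h p. h \<in> \<Lambda> \<Longrightarrow> p \<in> P \<Longrightarrow> 0 < L2_essinf M (\<Psi> h p)"
    and \<epsilon>: "\<epsilon> \<in> \<Lambda> \<rightarrow> (P \<rightarrow>\<^sub>E {0..})"
    and \<epsilon>_lower: "0 < Sup {ereal (\<epsilon> h p) | w p h. w \<in> W \<and> p \<in> Pij w \<and> h \<in> \<Lambda>}"
    and \<epsilon>_upper: "Sup {ereal (\<epsilon> h p) | w p h. w \<in> W \<and> p \<in> Pij w \<and> h \<in> \<Lambda>} < \<infinity>"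
  shows "\<exists>!\<Phi>. \<Phi> \<in> \<Lambda> \<rightarrow>\<^sub>E (P \<rightarrow>\<^sub>E L2_plus M) \<and>
    (\<forall>h\<in>\<Lambda>. \<forall>w\<in>W. \<forall>p\<in>Pij w. \<forall>\<psi>\<in>\<Psi> h p.
      \<Phi> h p = L2_class M (\<lambda>t. max (\<psi> t) (v_od M Pij \<Psi> h w + \<epsilon> h p)
                              - (\<epsilon> h p - (MIN q\<in>Pij w. \<epsilon> h q))))"
proof -
  interpret finite_measure M
    unfolding M by (intro finite_measureI) (simp add: emeasure_restrict_space emeasure_lborel_Icc_eq)
  define T where "T h w p \<psi> = (\<lambda>t. max (\<psi> t) (v_od M Pij \<Psi> h w + \<epsilon> h p)
    - (\<epsilon> h p - (MIN q\<in>Pij w. \<epsilon> h q)))" for h w p and \<psi> :: "real \<Rightarrow> real"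
  \<comment> \<open>\<Phi> receives only the path, whereas its formula mentions the O-D pair;
    \<open>od\<close> recovers the pair.\<close>
  define od where "od p = (THE w. w \<in> W \<and> p \<in> Pij w)" for p
  have od: "od p = w" if "w \<in> W" "p \<in> Pij w" for w p
    unfolding od_def using that \<open>disjoint_family_on Pij W\<close>
    by (intro the_equality) (auto simp: disjoint_family_on_def)
  have \<Psi>_L2: "\<Psi> h p \<in> L2 M" if "h \<in> \<Lambda>" "p \<in> P" for h p
    using \<Psi> that by (auto simp: L2_plus_def)
  have T_sq: "T h w p \<psi> \<in> square_integrable M" if "h \<in> \<Lambda>" "p \<in> P" "\<psi> \<in> \<Psi> h p" for h w p \<psi>
    unfolding T_def using L2_subset[OF \<Psi>_L2] that by (intro square_integrable_max_diff) auto
  have T_plus: "L2_class M (T h w p \<psi>) \<in> L2_plus M"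
    if "h \<in> \<Lambda>" "w \<in> W" "p \<in> Pij w" "\<psi> \<in> \<Psi> h p" for h w p \<psi>
  proof (rule L2_class_in_L2_plus)
    have p: "p \<in> P" and sub: "Pij w \<subseteq> P" and ne: "Pij w \<noteq> {}"
      using that by (auto simp: P)
    have fin: "finite (Pij w)"
      using sub \<open>finite P\<close> by (rule finite_subset)
    show "T h w p \<psi> \<in> square_integrable M" using T_sq that p by blast
    \<comment> \<open>Only nonnegativity survives in general, since \<open>real_of_ereal\<close>
      sends \<infinity> to 0; that is enough for the lower bound on \<open>T\<close>.\<close>
    have "0 \<le> v_path M \<Psi> h q" if "q \<in> P" for q
      using \<Psi>_essinf[OF \<open>h \<in> \<Lambda>\<close> that] by (simp add: v_path_def real_of_ereal_pos)
    then have "0 \<le> v_od M Pij \<Psi> h w" using sub fin ne by (auto simp: v_od_def)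
    moreover have "0 \<le> \<epsilon> h q" if "q \<in> P" for q
      using PiE_mem[OF funcset_mem[OF \<epsilon> \<open>h \<in> \<Lambda>\<close>] that] by simp
    then have "0 \<le> (MIN q\<in>Pij w. \<epsilon> h q)" using sub fin ne by auto
    \<comment> \<open>The bound holds at every t: dropping \<psi> from the maximum cancels
      \<open>\<epsilon> h p\<close> and leaves \<open>v_od\<close> plus the least tolerance.\<close>
    ultimately show "AE t in M. 0 \<le> T h w p \<psi> t" by (simp add: T_def)
  qed
  \<comment> \<open>A representative enters \<open>T\<close> only through its value at t, because
    \<open>v_od\<close> is computed from the classes; almost everywhere equality therefore carries
    over.\<close>
  have T_cong: "L2_class M (T h w p \<psi>) = L2_class M (T h w p \<psi>')"
    if "h \<in> \<Lambda>" "p \<in> P" "\<psi> \<in> \<Psi> h p" "\<psi>' \<in> \<Psi> h p" for h w p \<psi> \<psi>'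
    using T_sq that L2_rep_AE_eq[OF \<Psi>_L2[OF that(1,2)] that(3,4)]
    by (intro L2_class_cong) (auto simp: T_def)
  \<comment> \<open>Supplies a witness for the condition over all \<psi> in
    \<open>\<Psi> h p\<close>, which would be vacuous on an empty class; needed for uniqueness as
    well as for the definition of \<Phi>.\<close>
  have rep: "(SOME \<psi>. \<psi> \<in> \<Psi> h p) \<in> \<Psi> h p" if "h \<in> \<Lambda>" "p \<in> P" for h p
    using L2_nonempty[OF \<Psi>_L2[OF that]] by (simp add: some_in_eq)
  define \<Phi> where
    "\<Phi> = (\<lambda>h\<in>\<Lambda>. \<lambda>p\<in>P. L2_class M (T h (od p) p (SOME \<psi>. \<psi> \<in> \<Psi> h p)))"
  have "\<exists>!\<Phi>. \<Phi> \<in> \<Lambda> \<rightarrow>\<^sub>E (P \<rightarrow>\<^sub>E L2_plus M) \<and>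
    (\<forall>h\<in>\<Lambda>. \<forall>w\<in>W. \<forall>p\<in>Pij w. \<forall>\<psi>\<in>\<Psi> h p. \<Phi> h p = L2_class M (T h w p \<psi>))"
  proof (intro ex1I[of _ \<Phi>] conjI ballI)
    show "\<Phi> \<in> \<Lambda> \<rightarrow>\<^sub>E (P \<rightarrow>\<^sub>E L2_plus M)"
      using T_plus rep od by (auto simp: \<Phi>_def P)
  next
    fix h w p \<psi> assume "h \<in> \<Lambda>" "w \<in> W" "p \<in> Pij w" "\<psi> \<in> \<Psi> h p"
    moreover from this have "p \<in> P" by (auto simp: P)
    ultimately show "\<Phi> h p = L2_class M (T h w p \<psi>)"
      using T_cong[OF _ _ rep] od by (simp add: \<Phi>_def)
  next
    fix \<Phi>' assume \<Phi>': "\<Phi>' \<in> \<Lambda> \<rightarrow>\<^sub>E (P \<rightarrow>\<^sub>E L2_plus M) \<and>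
      (\<forall>h\<in>\<Lambda>. \<forall>w\<in>W. \<forall>p\<in>Pij w. \<forall>\<psi>\<in>\<Psi> h p. \<Phi>' h p = L2_class M (T h w p \<psi>))"
    show "\<Phi>' = \<Phi>"
    proof (intro ext)
      fix h p
      show "\<Phi>' h p = \<Phi> h p"
      proof (cases "h \<in> \<Lambda> \<and> p \<in> P")
        case True
        then obtain w where "w \<in> W" "p \<in> Pij w" by (auto simp: P)
        then show ?thesis using \<Phi>' True rep od by (simp add: \<Phi>_def)
      next
        case False
        \<comment> \<open>Outside \<Lambda> both operators are \<open>undefined\<close> as vectors;
          inside \<Lambda> but off \<open>P\<close> both vectors have the entry
          \<open>undefined\<close>.\<close>
        then show ?thesis using \<Phi>' by (auto simp: \<Phi>_def PiE_def extensional_def Pi_def)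
      qed
    qed
  qed
  then show ?thesis unfolding T_def .
qed

end
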